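(* Let $\varepsilon=\pm1$, let $m,n$ be real parameters, and let $Z(u,v,w)=(A(u,v,w),B(u,v,w),C(u,v,w))$ be defined by $$A(u,v,w)=\cos u\,\cosh w\,\sqrt{(\varepsilon n^2+m^2)\cos^2v+m^2\sin^2v},\qquad B(u,v,w)=m\,\sin u\,\sin v\,\sinh w,$$ $$C(u,v,w)=\cos v\,\sqrt{\frac{(\varepsilon n^2\cos^2u-m^2\sin^2u)(\varepsilon n^2\cosh^2w+m^2\sinh^2w)}{\varepsilon n^2+m^2}} .$$ Then the map $Z$ is a triple orthogonal system of quadrics in the Minkowski 3-space $\mathbb{R}^{2,1}$. More precisely, the quadrics are given by $$\mathcal{E}_1:\ \frac{x^2}{m^2\cosh^2w}+\frac{y^2}{m^2\sinh^2w}+\frac{z^2(m^2+\varepsilon n^2)}{\left(\varepsilon n^2\cosh^2w-m^2\sinh^2w\right)m^2}=1,$$ $$\mathcal{E}_2:\ \frac{x^2(m^2+\varepsilon n^2)}{m^2(m^2+\varepsilon n^2\cos^2v)}+\frac{(m^2+\varepsilon n^2)y^2}{\varepsilon m^2n^2\sin^2v}+\frac{z^2(m^2+\varepsilon n^2)}{\varepsilon m^2n^2\cos^2v}=1,$$ $$\mathcal{H}_1:\ \frac{x^2}{m^2\cos^2u}-\frac{y^2}{m^2\sin^2u}+\frac{z^2(m^2+\varepsilon n^2)}{m^2\left(m^2\sin^2u+\varepsilon n^2\cos^2u\right)}=1 .$$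
   Context: The Minkowski 3-space $\mathbb{R}^{2,1}$ is $\mathbb{R}^3$ with the inner product $\langle p,q\rangle=p_1q_1+p_2q_2-p_3q_3$. A triple (triply) orthogonal system of surfaces is a differentiable map $Z:W\to\mathbb{R}^{2,1}$ defined on an open set $W$ (with coordinates $(u,v,w)$) such that (a) the linear map $dZ_{(u,v,w)}$ is bijective for all $(u,v,w)\in W$; (b) $\langle Z_u,Z_v\rangle=\langle Z_u,Z_w\rangle=\langle Z_w,Z_v\rangle=0$. Its surfaces are the coordinate surfaces obtained by fixing one of $u,v,w$; it is a system of quadrics when these surfaces are (contained in) quadrics. In the equations of the quadrics, $(x,y,z)$ are the coordinates of $\mathbb{R}^{2,1}$ and the coordinate $w$, $v$, $u$, respectively, is fixed.
   Formalization: The printed equations fail on Z; ε is replaced by −ε in the z² denominators of E1, E2, H1 and the y² denominator of E2. Assumed: m, n, m²+εn² ≠ 0; the domain is where both radicands are positive and dZ is regular; equations hold where denominators do not vanish. *)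

theory Defs
  imports "HOL-Analysis.Analysis"
begin

definition minkowski :: "real^3 \<Rightarrow> real^3 \<Rightarrow> real" where
  "minkowski p q = p$1 * q$1 + p$2 * q$2 - p$3 * q$3"

text \<open>
  Curvilinear coordinates \<open>(u,v,w)\<close> are the components \<open>1,2,3\<close> of a point of \<open>real^3\<close>, so
  the derivative applied to \<open>axis i 1\<close> is \<open>Z\<^sub>u\<close>, \<open>Z\<^sub>v\<close>, \<open>Z\<^sub>w\<close> for \<open>i = 1, 2, 3\<close>.
\<close>

definition triply_orthogonal_system :: "(real^3) set \<Rightarrow> (real^3 \<Rightarrow> real^3) \<Rightarrow> bool" where
  "triply_orthogonal_system W Z \<longleftrightarrow>
     open W \<and> Z differentiable_on W \<and>
     (\<forall>p\<in>W. bij (frechet_derivative Z (at p))) \<and>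
     (\<forall>p\<in>W. \<forall>i j. i \<noteq> j \<longrightarrow>
        minkowski (frechet_derivative Z (at p) (axis i 1))
                  (frechet_derivative Z (at p) (axis j 1)) = 0)"

definition is_quadric :: "(real^3) set \<Rightarrow> bool" where
  "is_quadric S \<longleftrightarrow>
     (\<exists>(Q::real^3^3) (b::real^3) (c::real). transpose Q = Q \<and> Q \<noteq> 0 \<and>
        S = {p. p \<bullet> (Q *v p) + b \<bullet> p + c = 0})"

definition coordinate_surface :: "(real^3) set \<Rightarrow> (real^3 \<Rightarrow> real^3) \<Rightarrow> 3 \<Rightarrow> real \<Rightarrow> (real^3) set" where
  "coordinate_surface W Z i c = Z ` {p \<in> W. p$i = c}"

definition triply_orthogonal_system_of_quadrics :: "(real^3) set \<Rightarrow> (real^3 \<Rightarrow> real^3) \<Rightarrow> bool" where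
  "triply_orthogonal_system_of_quadrics W Z \<longleftrightarrow>
     triply_orthogonal_system W Z \<and>
     (\<forall>i c. \<exists>S. is_quadric S \<and> coordinate_surface W Z i c \<subseteq> S)"

definition A_radicand :: "real \<Rightarrow> real \<Rightarrow> real \<Rightarrow> real \<Rightarrow> real" where
  "A_radicand \<epsilon> m n v = (\<epsilon> * n^2 + m^2) * (cos v)^2 + m^2 * (sin v)^2"

definition C_radicand :: "real \<Rightarrow> real \<Rightarrow> real \<Rightarrow> real \<Rightarrow> real \<Rightarrow> real" where
  "C_radicand \<epsilon> m n u w =
     (\<epsilon> * n^2 * (cos u)^2 - m^2 * (sin u)^2) * (\<epsilon> * n^2 * (cosh w)^2 + m^2 * (sinh w)^2)
       / (\<epsilon> * n^2 + m^2)"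

definition Zmap :: "real \<Rightarrow> real \<Rightarrow> real \<Rightarrow> real^3 \<Rightarrow> real^3" where
  "Zmap \<epsilon> m n p =
     (let u = p$1; v = p$2; w = p$3 in
      vector [cos u * cosh w * sqrt (A_radicand \<epsilon> m n v),
              m * sin u * sin v * sinh w,
              cos v * sqrt (C_radicand \<epsilon> m n u w)])"

text \<open>
  The library \<open>sqrt\<close> is total (\<open>sqrt (- x) = - sqrt x\<close>), so the domain of the map has to be made
  explicit: both radicands must be positive. The last three conditions remove the focal points.
  With \<open>k = \<epsilon>m\<^sup>2n\<^sup>2/(m\<^sup>2 + \<epsilon>n\<^sup>2)\<close>, the coordinate surfaces belong to the confocal family
  \<open>x\<^sup>2/(m\<^sup>2 + \<lambda>) + y\<^sup>2/\<lambda> - z\<^sup>2/(k + \<lambda>) = 1\<close>, with \<open>\<lambda>\<close> equal to \<open>- m\<^sup>2 sin\<^sup>2 u\<close>, \<open>- k sin\<^sup>2 v\<close>,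
  \<open>m\<^sup>2 sinh\<^sup>2 w\<close> respectively. The conditions say that these three values are pairwise distinct;
  where two of them coincide, the derivative is singular.
\<close>

definition Zdomain :: "real \<Rightarrow> real \<Rightarrow> real \<Rightarrow> (real^3) set" where
  "Zdomain \<epsilon> m n =
     {p. let u = p$1; v = p$2; w = p$3 in
         A_radicand \<epsilon> m n v > 0 \<and> C_radicand \<epsilon> m n u w > 0 \<and>
         (sin u \<noteq> 0 \<or> sinh w \<noteq> 0) \<and>
         (m^2 + \<epsilon> * n^2) * (sinh w)^2 + \<epsilon> * n^2 * (sin v)^2 \<noteq> 0 \<and>
         (m^2 + \<epsilon> * n^2) * (sin u)^2 - \<epsilon> * n^2 * (sin v)^2 \<noteq> 0}"

text \<open>
  The equations of the paper, except that its \<open>\<epsilon>\<close> is replaced by \<open>-\<epsilon>\<close> in the denominators of the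
  \<open>z\<^sup>2\<close> terms of all three quadrics and of the \<open>y\<^sup>2\<close> term of \<open>quadric_E2\<close>. With the printed signs no
  point of the system satisfies the second equation, and the other two fail wherever \<open>z \<noteq> 0\<close>.
\<close>

definition quadric_E1 :: "real \<Rightarrow> real \<Rightarrow> real \<Rightarrow> real \<Rightarrow> (real^3) set" where
  "quadric_E1 \<epsilon> m n w =
     {p. let x = p$1; y = p$2; z = p$3 in
         x^2 / (m^2 * (cosh w)^2) + y^2 / (m^2 * (sinh w)^2)
       + z^2 * (m^2 + \<epsilon> * n^2) / ((- \<epsilon> * n^2 * (cosh w)^2 - m^2 * (sinh w)^2) * m^2) = 1}"

definition quadric_E2 :: "real \<Rightarrow> real \<Rightarrow> real \<Rightarrow> real \<Rightarrow> (real^3) set" where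
  "quadric_E2 \<epsilon> m n v =
     {p. let x = p$1; y = p$2; z = p$3 in
         x^2 * (m^2 + \<epsilon> * n^2) / (m^2 * (m^2 + \<epsilon> * n^2 * (cos v)^2))
       + (m^2 + \<epsilon> * n^2) * y^2 / (- \<epsilon> * m^2 * n^2 * (sin v)^2)
       + z^2 * (m^2 + \<epsilon> * n^2) / (- \<epsilon> * m^2 * n^2 * (cos v)^2) = 1}"

definition quadric_H1 :: "real \<Rightarrow> real \<Rightarrow> real \<Rightarrow> real \<Rightarrow> (real^3) set" where
  "quadric_H1 \<epsilon> m n u =
     {p. let x = p$1; y = p$2; z = p$3 in
         x^2 / (m^2 * (cos u)^2) - y^2 / (m^2 * (sin u)^2)
       + z^2 * (m^2 + \<epsilon> * n^2) / (m^2 * (m^2 * (sin u)^2 - \<epsilon> * n^2 * (cos u)^2)) = 1}"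

end

theory Submission
  imports Defs
begin

text \<open>
  The map \<open>Z\<close> parametrizes space by the confocal quadrics of Minkowski space. Put
  \<open>e = \<epsilon>n\<^sup>2\<close>, \<open>r = m\<^sup>2 + e\<close>, \<open>k = em\<^sup>2/r\<close>, and consider the family
  \<open>x\<^sup>2/(m\<^sup>2 + \<lambda>) + y\<^sup>2/\<lambda> - z\<^sup>2/(k + \<lambda>) = 1\<close>. After clearing denominators, the equation for a fixed
  point is a monic cubic in \<open>\<lambda>\<close>, and the formula for \<open>Z\<close> is made so that at \<open>Z(u,v,w)\<close> this cubic
  has the roots \<open>- m\<^sup>2 sin\<^sup>2 u\<close>, \<open>- k sin\<^sup>2 v\<close>, \<open>m\<^sup>2 sinh\<^sup>2 w\<close> (\<open>confocal_cubic_factorization\<close>). Each root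
  depends on one coordinate only, so fixing that coordinate keeps the image on one quadric of the
  family. Substituting the three roots and dividing by the denominators gives the equations
  of \<open>\<E>\<^sub>1\<close>, \<open>\<E>\<^sub>2\<close>, \<open>\<H>\<^sub>1\<close>.

  For orthogonality, the partial derivatives are written down explicitly and their Gram matrix for
  the Minkowski product is computed (\<open>Zpartial_gram\<close>): it is diagonal, and up to
  nonzero factors its entries are the products of differences of the three roots. The roots are
  pairwise distinct on the domain, so the frame is orthogonal and consists of non-null vectors.
  Pairing a vanishing combination of such a frame with each of its members shows that all
  coefficients are zero, which gives bijectivity of the differential without a determinant
  (\<open>bij_if_minkowski_orthogonal_frame\<close>).
\<close>

section \<open>Confocal quadrics\<close>

text \<open>
  This is \<open>x\<^sup>2/(a + l) + y\<^sup>2/l - z\<^sup>2/(k + l) = 1\<close> with the denominators cleared, so that the parameters at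
  which a denominator vanishes are included; the quadric is then a double coordinate plane,
  for example \<open>y\<^sup>2 = 0\<close> for \<open>l = 0\<close>. Coordinate surfaces do occur at such values.
\<close>
definition confocal_quadric :: "real \<Rightarrow> real \<Rightarrow> real \<Rightarrow> (real^3) set" where
  "confocal_quadric a k l =
     {p. l * (k + l) * (p$1)^2 + (a + l) * (k + l) * (p$2)^2 - (a + l) * l * (p$3)^2
         = (a + l) * l * (k + l)}"

lemma is_quadric_diagonal:
  assumes "a \<noteq> 0 \<or> b \<noteq> 0 \<or> c \<noteq> 0"
  shows "is_quadric {p. a * (p$1)^2 + b * (p$2)^2 + c * (p$3)^2 = d}"
proof -
  define q :: "real^3" where "q = vector [a, b, c]"
  define Q :: "real^3^3" where "Q = (\<chi> i j. if i = j then q$i else 0)"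
  have "transpose Q = Q"
    by (auto simp: Q_def transpose_def vec_eq_iff)
  moreover have "Q \<noteq> 0"
    using assms by (auto simp: Q_def q_def vec_eq_iff exhaust_3 forall_3)
  moreover have "{p. a * (p$1)^2 + b * (p$2)^2 + c * (p$3)^2 = d}
      = {p. p \<bullet> (Q *v p) + 0 \<bullet> p + - d = 0}"
    by (auto simp: Q_def q_def matrix_vector_mult_def inner_vec_def sum_3 power2_eq_square
        algebra_simps)
  ultimately show ?thesis
    unfolding is_quadric_def by blast
qed

text \<open>
  The three coefficients are the pairwise products of \<open>l\<close>, \<open>a + l\<close>, \<open>k + l\<close>. They all vanish
  only if two of these numbers are zero, which is impossible as \<open>0\<close>, \<open>a\<close>, \<open>k\<close> are distinct.
\<close>
lemma is_quadric_confocal: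
  assumes "a \<noteq> 0" "k \<noteq> 0" "k \<noteq> a"
  shows "is_quadric (confocal_quadric a k l)"
proof -
  have "l * (k + l) \<noteq> 0 \<or> (a + l) * (k + l) \<noteq> 0 \<or> - ((a + l) * l) \<noteq> 0"
    using assms by auto
  from is_quadric_diagonal[OF this, of "(a + l) * l * (k + l)"] show ?thesis
    by (simp add: confocal_quadric_def)
qed

lemma confocal_quadric_normal_form:
  assumes "a + l \<noteq> 0" "l \<noteq> 0" "k + l \<noteq> 0"
  shows "p \<in> confocal_quadric a k l \<longleftrightarrow>
    (p$1)^2 / (a + l) + (p$2)^2 / l - (p$3)^2 / (k + l) = 1"
  using assms by (simp add: confocal_quadric_def divide_simps) (simp add: algebra_simps)

section \<open>The coordinates are the parameters of the confocal quadrics through a point\<close>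

text \<open>
  Written in terms of \<open>sin\<^sup>2 u\<close> and \<open>sinh\<^sup>2 w\<close>, the radicand shows the factors \<open>k + \<lambda>\<close> at
  the two roots that depend on \<open>u\<close> and \<open>w\<close>, up to constants.
\<close>
lemma C_radicand_factors:
  "C_radicand \<epsilon> m n u w = (\<epsilon> * n^2 - (m^2 + \<epsilon> * n^2) * (sin u)^2)
     * (\<epsilon> * n^2 + (m^2 + \<epsilon> * n^2) * (sinh w)^2) / (m^2 + \<epsilon> * n^2)"
  by (simp add: C_radicand_def cos_squared_eq cosh_square_eq algebra_simps)

lemma Zmap_nth:
  "Zmap \<epsilon> m n p $ 1 = cos (p$1) * cosh (p$3) * sqrt (A_radicand \<epsilon> m n (p$2))"
  "Zmap \<epsilon> m n p $ 2 = m * sin (p$1) * sin (p$2) * sinh (p$3)"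
  "Zmap \<epsilon> m n p $ 3 = cos (p$2) * sqrt (C_radicand \<epsilon> m n (p$1) (p$3))"
  by (simp_all add: Zmap_def Let_def)

text \<open>
  The number \<open>k\<close> of the confocal family, that is, the value of \<open>- \<lambda>\<close> at which the \<open>z\<^sup>2\<close>
  denominator vanishes.
\<close>
definition focal :: "real \<Rightarrow> real \<Rightarrow> real \<Rightarrow> real" where
  "focal \<epsilon> m n = \<epsilon> * m^2 * n^2 / (m^2 + \<epsilon> * n^2)"

text \<open>
  Both sides are monic cubics in \<open>l\<close>. The squared coordinates are, up to sign, the residues of the partial fraction
  decomposition of the right-hand side divided by \<open>(m\<^sup>2 + l) l (k + l)\<close>, which is why
  they are products of a function of \<open>u\<close>, one of \<open>v\<close> and one of \<open>w\<close>. One identity in \<open>l\<close> serves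
  all three families, each of which evaluates it at another root.
\<close>
lemma confocal_cubic_factorization:
  fixes \<epsilon> m n :: real
  assumes K: "m^2 + \<epsilon> * n^2 \<noteq> 0" and p: "p \<in> Zdomain \<epsilon> m n"
  defines "k \<equiv> focal \<epsilon> m n" and "q \<equiv> Zmap \<epsilon> m n p"
  shows "(m^2 + l) * l * (k + l) - l * (k + l) * (q$1)^2 - (m^2 + l) * (k + l) * (q$2)^2
      + (m^2 + l) * l * (q$3)^2
    = (l + m^2 * (sin (p$1))^2) * (l + k * (sin (p$2))^2) * (l - m^2 * (sinh (p$3))^2)"
proof -
  define e where "e = \<epsilon> * n^2"
  define M where "M = m^2"
  define r where "r = M + e"
  define s1 where "s1 = (sin (p$1))^2"
  define s2 where "s2 = (sin (p$2))^2"
  define s3 where "s3 = (sinh (p$3))^2"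
  have r: "r \<noteq> 0" and k: "k = M * e / r" and e: "e = r - M"
    using K by (simp_all add: r_def e_def M_def k_def focal_def)
  have pos: "A_radicand \<epsilon> m n (p$2) > 0" "C_radicand \<epsilon> m n (p$1) (p$3) > 0"
    using p by (simp_all add: Zdomain_def Let_def)
  have x: "(q$1)^2 = (1 - s1) * (1 + s3) * (M + e * (1 - s2))"
    using pos by (simp add: q_def Zmap_nth power_mult_distrib A_radicand_def cos_squared_eq
        cosh_square_eq s1_def s2_def s3_def e_def M_def algebra_simps)
  have y: "(q$2)^2 = M * s1 * s2 * s3"
    by (simp add: q_def Zmap_nth power_mult_distrib s1_def s2_def s3_def M_def)
  have "(q$3)^2 = (1 - s2) * C_radicand \<epsilon> m n (p$1) (p$3)"
    using pos by (simp add: q_def Zmap_nth power_mult_distrib cos_squared_eq s2_def)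
  then have z: "(q$3)^2 = (1 - s2) * ((e - r * s1) * (e + r * s3) / r)"
    by (simp add: C_radicand_factors s1_def s3_def e_def M_def r_def)
  have "(M + l) * l * (k + l) - l * (k + l) * (q$1)^2 - (M + l) * (k + l) * (q$2)^2
      + (M + l) * l * (q$3)^2 = (l + M * s1) * (l + k * s2) * (l - M * s3)"
    using r unfolding x y z k e by (simp add: field_simps)
  then show ?thesis
    by (simp add: M_def s1_def s2_def s3_def)
qed

text \<open>The root of the cubic that depends on the \<open>i\<close>-th coordinate, at the value \<open>c\<close> of it.\<close>
definition surface_parameter :: "real \<Rightarrow> real \<Rightarrow> real \<Rightarrow> 3 \<Rightarrow> real \<Rightarrow> real" where
  "surface_parameter \<epsilon> m n i c =
     (if i = 1 then - (m^2 * (sin c)^2) else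
      if i = 2 then - (focal \<epsilon> m n * (sin c)^2) else m^2 * (sinh c)^2)"

lemma coordinate_surface_subset_confocal:
  assumes "m^2 + \<epsilon> * n^2 \<noteq> 0"
  shows "coordinate_surface (Zdomain \<epsilon> m n) (Zmap \<epsilon> m n) i c
    \<subseteq> confocal_quadric (m^2) (focal \<epsilon> m n) (surface_parameter \<epsilon> m n i c)"
proof -
  have "Zmap \<epsilon> m n p \<in> confocal_quadric (m^2) (focal \<epsilon> m n) (surface_parameter \<epsilon> m n i (p$i))"
    if p: "p \<in> Zdomain \<epsilon> m n" for p
    using confocal_cubic_factorization[OF assms p, of "surface_parameter \<epsilon> m n i (p$i)"]
      exhaust_3[of i]
    by (auto simp: confocal_quadric_def surface_parameter_def)
  then show ?thesis
    by (auto simp: coordinate_surface_def)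
qed

section \<open>Orthogonality\<close>

text \<open>
  The Minkowski product is indefinite, so orthogonal nonzero vectors may be linearly dependent; what
  makes the Euclidean argument work is that the frame vectors are not null. Pairing
  \<open>L h = 0\<close> with the \<open>j\<close>-th of them leaves \<open>h$j\<close> times its nonzero norm.
\<close>
lemma bij_if_minkowski_orthogonal_frame:
  fixes L :: "real^3 \<Rightarrow> real^3"
  assumes lin: "linear L"
    and orth: "\<And>i j. i \<noteq> j \<Longrightarrow> minkowski (L (axis i 1)) (L (axis j 1)) = 0"
    and nonnull: "\<And>i. minkowski (L (axis i 1)) (L (axis i 1)) \<noteq> 0"
  shows "bij L"
proof -
  have "h = 0" if "L h = 0" for h
  proof -
    have h: "h = (\<Sum>i\<in>UNIV. h$i *\<^sub>R axis i 1)"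
      by (simp add: vec_eq_iff axis_def sum_3 forall_3)
    have Lh: "L h = (\<Sum>i\<in>UNIV. h$i *\<^sub>R L (axis i 1))"
      by (subst h) (simp add: linear_sum[OF lin] linear_scale[OF lin])
    have "h$j = 0" for j
    proof -
      have "0 = minkowski (L h) (L (axis j 1))"
        using that by (simp add: minkowski_def)
      also have "\<dots> = (\<Sum>i\<in>UNIV. h$i * minkowski (L (axis i 1)) (L (axis j 1)))"
        unfolding Lh by (simp add: minkowski_def sum_3 algebra_simps)
      also have "\<dots> = (\<Sum>i\<in>UNIV. if i = j then h$j * minkowski (L (axis j 1)) (L (axis j 1)) else 0)"
        by (rule sum.cong) (auto simp: orth)
      finally show ?thesis
        using nonnull[of j] by simp
    qed
    then show ?thesis
      by (simp add: vec_eq_iff)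
  qed
  then have "inj L"
    using linear_injective_0[OF lin] by blast
  then show ?thesis
    using linear_injective_imp_surjective[OF lin] by (auto simp: bij_def)
qed

lemma has_derivative_vector_3:
  fixes f g h :: "'a::real_normed_vector \<Rightarrow> real"
  assumes "(f has_derivative f') F" "(g has_derivative g') F" "(h has_derivative h') F"
  shows "((\<lambda>x. vector [f x, g x, h x] :: real^3) has_derivative
    (\<lambda>x. vector [f' x, g' x, h' x])) F"
proof -
  have eq: "(\<lambda>x. vector [a x, b x, c x] :: real^3)
      = (\<lambda>x. a x *\<^sub>R axis 1 1 + b x *\<^sub>R axis 2 1 + c x *\<^sub>R axis 3 1)"
    for a b c :: "'a \<Rightarrow> real"
    by (simp add: fun_eq_iff vec_eq_iff forall_3 axis_def)
  show ?thesis
    unfolding eq by (intro derivative_intros assms)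
qed

definition Zpartial :: "real \<Rightarrow> real \<Rightarrow> real \<Rightarrow> real^3 \<Rightarrow> 3 \<Rightarrow> real^3" where
  "Zpartial \<epsilon> m n p i =
     (let u = p$1; v = p$2; w = p$3;
          s = sqrt (A_radicand \<epsilon> m n v); t = sqrt (C_radicand \<epsilon> m n u w) in
      if i = 1 then
        vector [- sin u * cosh w * s, m * cos u * sin v * sinh w,
          - cos v * sin u * cos u * (\<epsilon> * n^2 * (cosh w)^2 + m^2 * (sinh w)^2) / t]
      else if i = 2 then
        vector [- cos u * cosh w * (\<epsilon> * n^2) * sin v * cos v / s,
          m * sin u * cos v * sinh w, - sin v * t]
      else
        vector [cos u * sinh w * s, m * sin u * sin v * cosh w,
          cos v * (\<epsilon> * n^2 * (cos u)^2 - m^2 * (sin u)^2) * sinh w * cosh w / t])"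

lemma Zmap_has_derivative:
  assumes K: "m^2 + \<epsilon> * n^2 \<noteq> 0" and p: "p \<in> Zdomain \<epsilon> m n"
  shows "(Zmap \<epsilon> m n has_derivative (\<lambda>h. \<Sum>i\<in>UNIV. h$i *\<^sub>R Zpartial \<epsilon> m n p i)) (at p)"
proof -
  define s where "s = sqrt (A_radicand \<epsilon> m n (p$2))"
  define t where "t = sqrt (C_radicand \<epsilon> m n (p$1) (p$3))"
  have pos: "A_radicand \<epsilon> m n (p$2) > 0" "C_radicand \<epsilon> m n (p$1) (p$3) > 0"
    using p by (simp_all add: Zdomain_def Let_def)
  then have st: "s \<noteq> 0" "t \<noteq> 0"
    by (simp_all add: s_def t_def)
  have nth: "((\<lambda>q. q$i) has_derivative (\<lambda>h. h$i)) (at p)" for i :: 3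
    by (rule bounded_linear_imp_has_derivative) (rule bounded_linear_vec_nth)
  have hyperbolic: "((\<lambda>q. sinh (q$i)) has_derivative (\<lambda>h. h$i * cosh (p$i))) (at p)"
    "((\<lambda>q. cosh (q$i)) has_derivative (\<lambda>h. h$i * sinh (p$i))) (at p)" for i :: 3
    by (rule DERIV_compose_FDERIV[OF _ nth]; auto intro!: derivative_eq_intros)+
  have A: "((\<lambda>q. A_radicand \<epsilon> m n (q$2)) has_derivative
      (\<lambda>h. - 2 * (\<epsilon> * n^2) * sin (p$2) * cos (p$2) * h$2)) (at p)"
    unfolding A_radicand_def
    by (rule derivative_eq_intros nth | simp)+ (simp add: fun_eq_iff algebra_simps)
  have C: "((\<lambda>q. C_radicand \<epsilon> m n (q$1) (q$3)) has_derivative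
      (\<lambda>h. - 2 * sin (p$1) * cos (p$1) * (\<epsilon> * n^2 * (cosh (p$3))^2 + m^2 * (sinh (p$3))^2) * h$1
         + 2 * (\<epsilon> * n^2 * (cos (p$1))^2 - m^2 * (sin (p$1))^2) * sinh (p$3) * cosh (p$3) * h$3)) (at p)"
    unfolding C_radicand_def divide_inverse
    by (rule derivative_eq_intros nth hyperbolic refl)+
      (use K in \<open>simp add: fun_eq_iff field_simps power2_eq_square\<close>)
  have sA: "((\<lambda>q. sqrt (A_radicand \<epsilon> m n (q$2))) has_derivative
      (\<lambda>h. - (\<epsilon> * n^2) * sin (p$2) * cos (p$2) * h$2 / s)) (at p)"
    by (rule has_derivative_eq_rhs[OF has_derivative_real_sqrt[OF pos(1) A]])
      (use st in \<open>simp add: fun_eq_iff field_simps flip: s_def\<close>)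
  have sC: "((\<lambda>q. sqrt (C_radicand \<epsilon> m n (q$1) (q$3))) has_derivative
      (\<lambda>h. (- sin (p$1) * cos (p$1) * (\<epsilon> * n^2 * (cosh (p$3))^2 + m^2 * (sinh (p$3))^2) * h$1
         + (\<epsilon> * n^2 * (cos (p$1))^2 - m^2 * (sin (p$1))^2) * sinh (p$3) * cosh (p$3) * h$3) / t)) (at p)"
    by (rule has_derivative_eq_rhs[OF has_derivative_real_sqrt[OF pos(2) C]])
      (use st in \<open>simp add: fun_eq_iff field_simps flip: t_def\<close>)
  show ?thesis
    unfolding Zmap_def Let_def
    by (rule has_derivative_eq_rhs, rule has_derivative_vector_3,
        (rule sA sC nth hyperbolic refl derivative_eq_intros)+)
      (use st in \<open>simp add: fun_eq_iff vec_eq_iff forall_3 sum_3 Zpartial_def Let_def field_simps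
        flip: s_def t_def\<close>)
qed

text \<open>
  For the roots \<open>\<lambda> = - m\<^sup>2 U\<close>, \<open>\<mu> = - k V\<close>, \<open>\<nu> = m\<^sup>2 W\<close> of the cubic, the factors \<open>U + W\<close>,
  \<open>r U - e V\<close>, \<open>r W + e V\<close> are, up to nonzero constants, the differences \<open>\<nu> - \<lambda>\<close>, \<open>\<mu> - \<lambda>\<close>, \<open>\<nu> - \<mu>\<close>. The norms are those
  known for elliptic coordinates, \<open>(\<lambda> - \<mu>)(\<lambda> - \<nu>)\<close> over a factor depending on \<open>\<lambda>\<close> alone, and
  cyclically; they are stated multiplied out to avoid divisions.
\<close>
lemma Zpartial_gram:
  fixes \<epsilon> m n :: real
  assumes K: "m^2 + \<epsilon> * n^2 \<noteq> 0" and p: "p \<in> Zdomain \<epsilon> m n"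
  defines "r \<equiv> m^2 + \<epsilon> * n^2" and "e \<equiv> \<epsilon> * n^2" and "D \<equiv> Zpartial \<epsilon> m n p"
    and "U \<equiv> (sin (p$1))^2" and "V \<equiv> (sin (p$2))^2" and "W \<equiv> (sinh (p$3))^2"
  shows "minkowski (D 1) (D 2) = 0" "minkowski (D 1) (D 3) = 0" "minkowski (D 2) (D 3) = 0"
    and "minkowski (D 1) (D 1) * (e - r * U) = - (m^2 * (U + W) * (r * U - e * V))"
    and "minkowski (D 2) (D 2) * (r * (r - e * V)) = m^2 * (r * U - e * V) * (r * W + e * V)"
    and "minkowski (D 3) (D 3) * (e + r * W) = m^2 * (U + W) * (r * W + e * V)"
proof -
  define su cu sv cv sh ch where trig:
    "su = sin (p$1)" "cu = cos (p$1)" "sv = sin (p$2)" "cv = cos (p$2)"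
    "sh = sinh (p$3)" "ch = cosh (p$3)"
  define s where "s = sqrt (A_radicand \<epsilon> m n (p$2))"
  define t where "t = sqrt (C_radicand \<epsilon> m n (p$1) (p$3))"
  \<comment> \<open>The two factors in the numerator of the radicand of \<open>C\<close>. The derivative of \<open>t\<close> with respect to
    \<open>u\<close> keeps \<open>R\<close> and that with respect to \<open>w\<close> keeps \<open>P\<close>, and \<open>t\<^sup>2 = P R / r\<close>.\<close>
  define P where "P = e * cu^2 - m^2 * su^2"
  define R where "R = e * ch^2 + m^2 * sh^2"
  have pos: "A_radicand \<epsilon> m n (p$2) > 0" "C_radicand \<epsilon> m n (p$1) (p$3) > 0"
    using p by (simp_all add: Zdomain_def Let_def)
  then have st: "s \<noteq> 0" "t \<noteq> 0"
    by (simp_all add: s_def t_def)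
  have cu: "cu^2 = 1 - U" and cv: "cv^2 = 1 - V" and ch: "ch^2 = 1 + W"
    and su: "su^2 = U" and sv: "sv^2 = V" and sh: "sh^2 = W"
    by (simp_all add: trig U_def V_def W_def cos_squared_eq cosh_square_eq)
  have P: "P = e - r * U" and R: "R = e + r * W"
    by (simp_all add: P_def R_def cu ch su sh r_def e_def algebra_simps)
  have r: "r \<noteq> 0" and m: "m^2 = r - e"
    using K by (simp_all add: r_def e_def)
  have s2: "s^2 = r - e * V"
    using pos(1) by (simp add: s_def A_radicand_def e_def r_def V_def cos_squared_eq algebra_simps)
  have t2: "t^2 = P * R / r"
    using pos(2) by (simp add: t_def C_radicand_def P_def R_def e_def r_def trig algebra_simps)
  have PR: "P \<noteq> 0" "R \<noteq> 0"
    using t2 st(2) by auto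
  have quot: "R^2 / t^2 = r * R / P" "P^2 / t^2 = r * P / R"
    using PR r unfolding t2 by (simp_all add: power2_eq_square)
  have D1: "D 1 = vector [- su * ch * s, m * cu * sv * sh, - cv * su * cu * R / t]"
    and D2: "D 2 = vector [- cu * ch * e * sv * cv / s, m * su * cv * sh, - sv * t]"
    and D3: "D 3 = vector [cu * sh * s, m * su * sv * ch, cv * P * sh * ch / t]"
    by (simp_all add: D_def Zpartial_def Let_def trig s_def t_def e_def R_def P_def)
  have "minkowski (D 1) (D 2)
      = su * cu * sv * cv * (e * ch^2 + m^2 * sh^2 - R)"
    using st by (simp add: D1 D2 minkowski_def power2_eq_square algebra_simps)
  then show "minkowski (D 1) (D 2) = 0"
    by (simp add: R_def)
  have "minkowski (D 1) (D 3)
      = su * cu * sh * ch * (m^2 * sv^2 + cv^2 * (P * R / t^2) - s^2)"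
    using st by (simp add: D1 D3 minkowski_def power2_eq_square algebra_simps)
  then show "minkowski (D 1) (D 3) = 0"
    using PR by (simp add: t2 s2 sv cv m algebra_simps)
  have "minkowski (D 2) (D 3)
      = sv * cv * sh * ch * (- e * cu^2 + m^2 * su^2 + P)"
    using st by (simp add: D2 D3 minkowski_def power2_eq_square algebra_simps)
  then show "minkowski (D 2) (D 3) = 0"
    by (simp add: P_def)
  have "minkowski (D 1) (D 1) = su^2 * ch^2 * s^2 + m^2 * cu^2 * sv^2 * sh^2
      - cv^2 * su^2 * cu^2 * (R^2 / t^2)"
    by (simp add: D1 minkowski_def power2_eq_square)
  also have "\<dots> = U * (1 + W) * (r - e * V) + (r - e) * (1 - U) * V * W
      - (1 - V) * U * (1 - U) * (r * R / P)"
    by (simp add: su ch s2 cu sv sh cv quot m)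
  finally have norm: "minkowski (D 1) (D 1) = \<dots>" .
  have "minkowski (D 1) (D 1) * P = (U * (1 + W) * (r - e * V) + (r - e) * (1 - U) * V * W) * P
      - (1 - V) * U * (1 - U) * r * R"
    unfolding norm using PR by (simp add: field_simps)
  then show "minkowski (D 1) (D 1) * (e - r * U) = - (m^2 * (U + W) * (r * U - e * V))"
    unfolding m P R by algebra
  have "minkowski (D 2) (D 2) = cu^2 * ch^2 * e^2 * sv^2 * cv^2 / s^2 + m^2 * su^2 * cv^2 * sh^2
      - sv^2 * t^2"
    by (simp add: D2 minkowski_def power2_eq_square)
  also have "\<dots> = (1 - U) * (1 + W) * e^2 * V * (1 - V) / s^2 + (r - e) * U * (1 - V) * W
      - V * (P * R / r)"
    by (simp add: su ch cu sv sh cv t2 m)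
  finally have "minkowski (D 2) (D 2) * (r * s^2)
      = (1 - U) * (1 + W) * e^2 * V * (1 - V) * r + ((r - e) * U * (1 - V) * W * r - V * P * R) * s^2"
    using r st by (simp add: field_simps)
  then show "minkowski (D 2) (D 2) * (r * (r - e * V)) = m^2 * (r * U - e * V) * (r * W + e * V)"
    unfolding m P R s2 by algebra
  have "minkowski (D 3) (D 3) = cu^2 * sh^2 * s^2 + m^2 * su^2 * sv^2 * ch^2
      - cv^2 * sh^2 * ch^2 * (P^2 / t^2)"
    by (simp add: D3 minkowski_def power2_eq_square)
  also have "\<dots> = (1 - U) * W * (r - e * V) + (r - e) * U * V * (1 + W)
      - (1 - V) * W * (1 + W) * (r * P / R)"
    by (simp add: su ch s2 cu sv sh cv quot m)
  finally have norm: "minkowski (D 3) (D 3) = \<dots>" .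
  have "minkowski (D 3) (D 3) * R = ((1 - U) * W * (r - e * V) + (r - e) * U * V * (1 + W)) * R
      - (1 - V) * W * (1 + W) * r * P"
    unfolding norm using PR by (simp add: field_simps)
  then show "minkowski (D 3) (D 3) * (e + r * W) = m^2 * (U + W) * (r * W + e * V)"
    unfolding m P R by algebra
qed

lemma open_Zdomain: "open (Zdomain \<epsilon> m n)"
proof -
  have "Zdomain \<epsilon> m n = {p. 0 < A_radicand \<epsilon> m n (p$2)} \<inter> {p. 0 < C_radicand \<epsilon> m n (p$1) (p$3)}
    \<inter> ({p. sin (p$1) \<noteq> 0} \<union> {p. sinh (p$3) \<noteq> 0})
    \<inter> {p. (m^2 + \<epsilon> * n^2) * (sinh (p$3))^2 + \<epsilon> * n^2 * (sin (p$2))^2 \<noteq> 0}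
    \<inter> {p. (m^2 + \<epsilon> * n^2) * (sin (p$1))^2 - \<epsilon> * n^2 * (sin (p$2))^2 \<noteq> 0}"
    by (auto simp: Zdomain_def Let_def)
  moreover have "open \<dots>"
    unfolding A_radicand_def C_radicand_def divide_inverse
    by (intro open_Int open_Un open_Collect_less open_Collect_neq continuous_intros)
  ultimately show ?thesis
    by simp
qed

lemma triply_orthogonal_Zmap:
  assumes m: "m \<noteq> 0" and K: "m^2 + \<epsilon> * n^2 \<noteq> 0"
  shows "triply_orthogonal_system (Zdomain \<epsilon> m n) (Zmap \<epsilon> m n)"
proof -
  have frame: "frechet_derivative (Zmap \<epsilon> m n) (at p) (axis i 1) = Zpartial \<epsilon> m n p i"
    and lin: "linear (frechet_derivative (Zmap \<epsilon> m n) (at p))"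
    and diff: "Zmap \<epsilon> m n differentiable at p" if "p \<in> Zdomain \<epsilon> m n" for p i
  proof -
    note D = Zmap_has_derivative[OF K that]
    show "Zmap \<epsilon> m n differentiable at p"
      using D by (rule differentiableI)
    then show "linear (frechet_derivative (Zmap \<epsilon> m n) (at p))"
      by (rule linear_frechet_derivative)
    have "frechet_derivative (Zmap \<epsilon> m n) (at p) (axis i 1)
        = (\<Sum>j\<in>UNIV. axis i 1 $ j *\<^sub>R Zpartial \<epsilon> m n p j)"
      using frechet_derivative_at[OF D] by (simp add: fun_eq_iff)
    also have "\<dots> = Zpartial \<epsilon> m n p i"
      using exhaust_3[of i] by (auto simp: sum_3 axis_def)
    finally show "frechet_derivative (Zmap \<epsilon> m n) (at p) (axis i 1) = Zpartial \<epsilon> m n p i" .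
  qed
  have orth: "minkowski (Zpartial \<epsilon> m n p i) (Zpartial \<epsilon> m n p j) = 0"
    if "p \<in> Zdomain \<epsilon> m n" "i \<noteq> j" for p i j
  proof -
    have sym: "minkowski x y = minkowski y x" for x y
      by (simp add: minkowski_def mult.commute)
    show ?thesis
      using that(2) exhaust_3[of i] exhaust_3[of j] Zpartial_gram(1-3)[OF K that(1)]
      by (auto simp: sym)
  qed
  have nonnull: "minkowski (Zpartial \<epsilon> m n p i) (Zpartial \<epsilon> m n p i) \<noteq> 0"
    if p: "p \<in> Zdomain \<epsilon> m n" for p i
  proof -
    have "(sin (p$1))^2 + (sinh (p$3))^2 \<noteq> 0"
      "(m^2 + \<epsilon> * n^2) * (sinh (p$3))^2 + \<epsilon> * n^2 * (sin (p$2))^2 \<noteq> 0"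
      "(m^2 + \<epsilon> * n^2) * (sin (p$1))^2 - \<epsilon> * n^2 * (sin (p$2))^2 \<noteq> 0"
      using p by (auto simp: Zdomain_def Let_def sum_power2_eq_zero_iff)
    then show ?thesis
      using exhaust_3[of i] m Zpartial_gram(4-6)[OF K p] by force
  qed
  have "bij (frechet_derivative (Zmap \<epsilon> m n) (at p))" if "p \<in> Zdomain \<epsilon> m n" for p
    by (rule bij_if_minkowski_orthogonal_frame[OF lin[OF that]])
      (simp_all add: frame[OF that] orth[OF that] nonnull[OF that])
  then show ?thesis
    using open_Zdomain orth frame diff
    by (auto simp: triply_orthogonal_system_def intro!: differentiable_at_imp_differentiable_on)
qed

section \<open>The three families in normal form\<close>

text \<open>
  Each of the three equations becomes the normal form of the confocal quadric with parameter
  \<open>\<lambda> = surface_parameter \<epsilon> m n i c\<close> once the factors \<open>m\<^sup>2 + \<epsilon>n\<^sup>2\<close> are cancelled. The hypotheses make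
  \<open>\<lambda>\<close>, \<open>m\<^sup>2 + \<lambda>\<close> and \<open>k + \<lambda>\<close> nonzero; those about the radicands and their factors hold as soon
  as the coordinate surface is nonempty.
\<close>
lemma quadric_E1_eq_confocal:
  assumes m: "m \<noteq> 0" and K: "m^2 + \<epsilon> * n^2 \<noteq> 0" and w: "sinh w \<noteq> 0"
    and R: "\<epsilon> * n^2 + (m^2 + \<epsilon> * n^2) * (sinh w)^2 \<noteq> 0"
  shows "quadric_E1 \<epsilon> m n w = confocal_quadric (m^2) (focal \<epsilon> m n) (surface_parameter \<epsilon> m n 3 w)"
proof -
  define l where "l = m^2 * (sinh w)^2"
  have a: "m^2 * (cosh w)^2 = m^2 + l"
    by (simp add: l_def cosh_square_eq algebra_simps)
  have k: "(- \<epsilon> * n^2 * (cosh w)^2 - m^2 * (sinh w)^2) * m^2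
      = - ((m^2 + \<epsilon> * n^2) * (focal \<epsilon> m n + l))"
    using K by (simp add: l_def focal_def cosh_square_eq divide_simps) algebra
  have "(m^2 + \<epsilon> * n^2) * (focal \<epsilon> m n + l) = m^2 * (\<epsilon> * n^2 + (m^2 + \<epsilon> * n^2) * (sinh w)^2)"
    using K by (simp add: l_def focal_def divide_simps) algebra
  then have nz: "l \<noteq> 0" "m^2 + l \<noteq> 0" "focal \<epsilon> m n + l \<noteq> 0"
    using m w R a by (auto simp: l_def)
  show ?thesis
    using nz K unfolding quadric_E1_def Let_def a k unfolding l_def[symmetric]
    by (auto simp: surface_parameter_def l_def[symmetric] confocal_quadric_normal_form)
qed

lemma quadric_E2_eq_confocal:
  assumes "\<epsilon> \<noteq> 0" "m \<noteq> 0" "n \<noteq> 0" and K: "m^2 + \<epsilon> * n^2 \<noteq> 0" and v: "sin v \<noteq> 0" "cos v \<noteq> 0"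
    and A: "A_radicand \<epsilon> m n v \<noteq> 0"
  shows "quadric_E2 \<epsilon> m n v = confocal_quadric (m^2) (focal \<epsilon> m n) (surface_parameter \<epsilon> m n 2 v)"
proof -
  define r where "r = m^2 + \<epsilon> * n^2"
  define l where "l = - (focal \<epsilon> m n * (sin v)^2)"
  have r: "r \<noteq> 0"
    using K by (simp add: r_def)
  have A': "m^2 + \<epsilon> * n^2 * (cos v)^2 \<noteq> 0"
    using A by (simp add: A_radicand_def sin_squared_eq algebra_simps)
  have a: "m^2 * (m^2 + \<epsilon> * n^2 * (cos v)^2) = r * (m^2 + l)"
    using K by (simp add: r_def l_def focal_def cos_squared_eq divide_simps) algebra
  have b: "- \<epsilon> * m^2 * n^2 * (sin v)^2 = r * l"
    using K by (simp add: r_def l_def focal_def)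
  have k: "- \<epsilon> * m^2 * n^2 * (cos v)^2 = - (r * (focal \<epsilon> m n + l))"
    using K by (simp add: r_def l_def focal_def cos_squared_eq divide_simps) algebra
  have "r * l \<noteq> 0" "r * (m^2 + l) \<noteq> 0" "- (r * (focal \<epsilon> m n + l)) \<noteq> 0"
    unfolding a[symmetric] b[symmetric] k[symmetric] using assms A' by auto
  then have nz: "l \<noteq> 0" "m^2 + l \<noteq> 0" "focal \<epsilon> m n + l \<noteq> 0"
    by auto
  show ?thesis
    using nz r unfolding quadric_E2_def Let_def a b k r_def[symmetric]
    by (auto simp: surface_parameter_def l_def[symmetric] confocal_quadric_normal_form)
qed

lemma quadric_H1_eq_confocal:
  assumes m: "m \<noteq> 0" and K: "m^2 + \<epsilon> * n^2 \<noteq> 0" and u: "sin u \<noteq> 0" "cos u \<noteq> 0"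
    and P: "\<epsilon> * n^2 - (m^2 + \<epsilon> * n^2) * (sin u)^2 \<noteq> 0"
  shows "quadric_H1 \<epsilon> m n u = confocal_quadric (m^2) (focal \<epsilon> m n) (surface_parameter \<epsilon> m n 1 u)"
proof -
  define l where "l = - (m^2 * (sin u)^2)"
  have a: "m^2 * (cos u)^2 = m^2 + l"
    by (simp add: l_def cos_squared_eq algebra_simps)
  have b: "m^2 * (sin u)^2 = - l"
    by (simp add: l_def)
  have k: "m^2 * (m^2 * (sin u)^2 - \<epsilon> * n^2 * (cos u)^2)
      = - ((m^2 + \<epsilon> * n^2) * (focal \<epsilon> m n + l))"
    using K by (simp add: l_def focal_def cos_squared_eq divide_simps) algebra
  have "(m^2 + \<epsilon> * n^2) * (focal \<epsilon> m n + l) = m^2 * (\<epsilon> * n^2 - (m^2 + \<epsilon> * n^2) * (sin u)^2)"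
    using K by (simp add: l_def focal_def divide_simps) algebra
  then have nz: "l \<noteq> 0" "m^2 + l \<noteq> 0" "focal \<epsilon> m n + l \<noteq> 0"
    using m u P unfolding a[symmetric] by (auto simp: l_def)
  show ?thesis
    using nz K unfolding quadric_H1_def Let_def k unfolding a b
    by (auto simp: surface_parameter_def l_def[symmetric] confocal_quadric_normal_form)
qed

text \<open>
  If a denominator vanishes, division by zero only deletes that square from the equation. One square
  with a nonzero coefficient remains: \<open>x\<^sup>2\<close> for the first and last surface, \<open>y\<^sup>2\<close> for the second, whose
  \<open>x\<^sup>2\<close> denominator can be zero.
\<close>
lemma is_quadric_normal_forms:
  assumes "\<epsilon> \<noteq> 0" "m \<noteq> 0" "n \<noteq> 0" "m^2 + \<epsilon> * n^2 \<noteq> 0"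
  shows "is_quadric (quadric_E1 \<epsilon> m n w)"
    and "sin v \<noteq> 0 \<Longrightarrow> is_quadric (quadric_E2 \<epsilon> m n v)"
    and "cos u \<noteq> 0 \<Longrightarrow> is_quadric (quadric_H1 \<epsilon> m n u)"
proof -
  show "is_quadric (quadric_E1 \<epsilon> m n w)"
    using assms is_quadric_diagonal[of "1 / (m^2 * (cosh w)^2)" "1 / (m^2 * (sinh w)^2)"
        "(m^2 + \<epsilon> * n^2) / ((- \<epsilon> * n^2 * (cosh w)^2 - m^2 * (sinh w)^2) * m^2)" 1]
    by (simp add: quadric_E1_def Let_def mult.commute)
  show "is_quadric (quadric_E2 \<epsilon> m n v)" if "sin v \<noteq> 0"
    using assms that is_quadric_diagonal[of "(m^2 + \<epsilon> * n^2) / (m^2 * (m^2 + \<epsilon> * n^2 * (cos v)^2))"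
        "(m^2 + \<epsilon> * n^2) / (- \<epsilon> * m^2 * n^2 * (sin v)^2)"
        "(m^2 + \<epsilon> * n^2) / (- \<epsilon> * m^2 * n^2 * (cos v)^2)" 1]
    by (simp add: quadric_E2_def Let_def mult.commute)
  show "is_quadric (quadric_H1 \<epsilon> m n u)" if "cos u \<noteq> 0"
    using assms that is_quadric_diagonal[of "1 / (m^2 * (cos u)^2)" "- 1 / (m^2 * (sin u)^2)"
        "(m^2 + \<epsilon> * n^2) / (m^2 * (m^2 * (sin u)^2 - \<epsilon> * n^2 * (cos u)^2))" 1]
    by (simp add: quadric_H1_def Let_def mult.commute)
qed

theorem theorem6p1:
  fixes \<epsilon> m n :: real
  assumes "\<epsilon> = 1 \<or> \<epsilon> = -1"
    and "m \<noteq> 0" and "n \<noteq> 0" and "m^2 + \<epsilon> * n^2 \<noteq> 0"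
  shows "triply_orthogonal_system_of_quadrics (Zdomain \<epsilon> m n) (Zmap \<epsilon> m n) \<and>
    (\<forall>w. sinh w \<noteq> 0 \<longrightarrow> is_quadric (quadric_E1 \<epsilon> m n w) \<and>
        coordinate_surface (Zdomain \<epsilon> m n) (Zmap \<epsilon> m n) 3 w \<subseteq> quadric_E1 \<epsilon> m n w) \<and>
    (\<forall>v. sin v \<noteq> 0 \<and> cos v \<noteq> 0 \<longrightarrow> is_quadric (quadric_E2 \<epsilon> m n v) \<and>
        coordinate_surface (Zdomain \<epsilon> m n) (Zmap \<epsilon> m n) 2 v \<subseteq> quadric_E2 \<epsilon> m n v) \<and>
    (\<forall>u. sin u \<noteq> 0 \<and> cos u \<noteq> 0 \<longrightarrow> is_quadric (quadric_H1 \<epsilon> m n u) \<and>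
        coordinate_surface (Zdomain \<epsilon> m n) (Zmap \<epsilon> m n) 1 u \<subseteq> quadric_H1 \<epsilon> m n u)"
proof -
  let ?W = "Zdomain \<epsilon> m n" and ?Z = "Zmap \<epsilon> m n"
  have \<epsilon>: "\<epsilon> \<noteq> 0"
    using assms(1) by auto
  note K = assms(4)
  have "focal \<epsilon> m n \<noteq> 0" "focal \<epsilon> m n \<noteq> m^2"
    using \<epsilon> assms by (auto simp: focal_def field_simps power2_eq_square)
  then have confocal: "is_quadric (confocal_quadric (m^2) (focal \<epsilon> m n) l)" for l
    using assms(2) by (intro is_quadric_confocal) auto
  note surface = coordinate_surface_subset_confocal[OF K]
  have system: "triply_orthogonal_system_of_quadrics ?W ?Z"
    unfolding triply_orthogonal_system_of_quadrics_def
    using triply_orthogonal_Zmap[OF assms(2) K] surface confocal by blast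
  have regular: "A_radicand \<epsilon> m n (p$2) \<noteq> 0" "\<epsilon> * n^2 - (m^2 + \<epsilon> * n^2) * (sin (p$1))^2 \<noteq> 0"
    "\<epsilon> * n^2 + (m^2 + \<epsilon> * n^2) * (sinh (p$3))^2 \<noteq> 0" if "p \<in> ?W" for p
    using that by (auto simp: Zdomain_def Let_def C_radicand_factors)
  \<comment> \<open>An empty coordinate surface is contained in everything; a point of \<open>?W\<close> on a nonempty one
    shows by \<open>regular\<close> that the denominators are nonzero.\<close>
  have E1: "coordinate_surface ?W ?Z 3 w \<subseteq> quadric_E1 \<epsilon> m n w" if w: "sinh w \<noteq> 0" for w
  proof (cases "\<exists>p\<in>?W. p$3 = w")
    case True
    then show ?thesis
      using quadric_E1_eq_confocal[OF assms(2) K w] regular surface by metis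
  qed (auto simp: coordinate_surface_def)
  have E2: "coordinate_surface ?W ?Z 2 v \<subseteq> quadric_E2 \<epsilon> m n v"
    if v: "sin v \<noteq> 0" "cos v \<noteq> 0" for v
  proof (cases "\<exists>p\<in>?W. p$2 = v")
    case True
    then show ?thesis
      using quadric_E2_eq_confocal[OF \<epsilon> assms(2,3) K v] regular surface by metis
  qed (auto simp: coordinate_surface_def)
  have H1: "coordinate_surface ?W ?Z 1 u \<subseteq> quadric_H1 \<epsilon> m n u"
    if u: "sin u \<noteq> 0" "cos u \<noteq> 0" for u
  proof (cases "\<exists>p\<in>?W. p$1 = u")
    case True
    then show ?thesis
      using quadric_H1_eq_confocal[OF assms(2) K u] regular surface by metis
  qed (auto simp: coordinate_surface_def)
  show ?thesis
    using system E1 E2 H1 is_quadric_normal_forms[OF \<epsilon> assms(2-4)] by blast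
qed

end
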